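(* Assume $(A,Z)$ is an evanescent $m$-pair, $a\in A$, $p\in\mathbb{N}$, and $f$ is continuous and bounded. Then $$\mathrm{Sol}(E)+Z=\mathrm{Sol}_p(E)+Z=\mathrm{Sol}_\infty(E)+Z=\Delta^{-m}b+Z.$$
   Context: $\mathbb{N}$ is the set of positive integers and $\mathbb{R}^{\mathbb{N}}$ is the real vector space of all real sequences $x:\mathbb{N}\to\mathbb{R}$. For $x\in\mathbb{R}^{\mathbb{N}}$, $\Delta x_n=x_{n+1}-x_n$ and $\Delta^m$ is the $m$-th iterate of $\Delta$. Standing assumptions: $m\in\mathbb{N}$, $f:\mathbb{R}\to\mathbb{R}$, $\sigma:\mathbb{N}\to\mathbb{N}$ with $\lim_{n\to\infty}\sigma(n)=\infty$, and $a,b\in\mathbb{R}^{\mathbb{N}}$. The equation (E) is $$\Delta^m x_n=a_nf(x_{\sigma(n)})+b_n .$$ For $p\in\mathbb{N}$, a sequence $x$ is a $p$-solution of (E) if the equality (E) holds for every $n\ge p$; $x$ is a solution if it is a $p$-solution for some $p\in\mathbb{N}$; $x$ is a full solution if it is a $p$-solution for every $p\in\mathbb{N}$. $\mathrm{Sol}(E)$, $\mathrm{Sol}_p(E)$, $\mathrm{Sol}_\infty(E)$ denote the sets of all full solutions, all $p$-solutions, and all solutions, respectively. $\Delta^{-m}b=\{y\in\mathbb{R}^{\mathbb{N}}:\Delta^m y=b\}$. Sums of sets of sequences are $X+Y=\{x+y:x\in X,\ y\in Y\}$. $\mathrm{Fin}$ is the space of sequences with only finitely many nonzero terms, $\mathrm{O}(1)$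 the space of bounded sequences, $\mathrm{o}(1)$ the space of sequences convergent to $0$. Products of sequences are pointwise. An $m$-pair is a pair $(A,Z)$ of linear subspaces of $\mathbb{R}^{\mathbb{N}}$ such that $\mathrm{Fin}\subset Z$ (equivalently $Z+\mathrm{Fin}\subset Z$), $u\alpha\in A$ for all $u\in\mathrm{O}(1)$ and $\alpha\in A$, and $A\subset\Delta^mZ$, where $\Delta^mZ=\{\Delta^mz:z\in Z\}$. An $m$-pair $(A,Z)$ is evanescent if $Z\subset\mathrm{o}(1)$. *)

theory Defs
  imports "HOL-Analysis.Analysis" "HOL-Library.Function_Algebras"
begin

text \<open>
  Indexing convention: a sequence is a function on \<^typ>\<open>nat\<close>, and the index \<open>k\<close> here stands for the
  positive integer \<open>k + 1\<close>.  The indices \<open>n\<close>, \<open>p\<close> and the values of \<open>\<sigma>\<close> are all relabelled in this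
  way, so the first term has index \<open>0\<close> and every \<^typ>\<open>nat\<close> is a legitimate index; nothing below
  uses the numerical value of an index, only the order and the successor.  The order \<open>m\<close> of the
  difference operator counts iterations and is not relabelled.
\<close>

instantiation "fun" :: (type, real_vector) real_vector
begin

definition scaleR_fun :: "real \<Rightarrow> ('a \<Rightarrow> 'b) \<Rightarrow> 'a \<Rightarrow> 'b"
  where "scaleR_fun c x = (\<lambda>n. c *\<^sub>R x n)"

instance
  by standard (simp_all add: scaleR_fun_def fun_eq_iff scaleR_add_right scaleR_add_left)

end

lemma scaleR_fun_apply [simp]: "(c *\<^sub>R x) n = c *\<^sub>R x n"
  by (simp add: scaleR_fun_def)

definition fwd_diff :: "(nat \<Rightarrow> real) \<Rightarrow> (nat \<Rightarrow> real)"
  where "fwd_diff x = (\<lambda>n. x (Suc n) - x n)"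

definition is_p_solution ::
    "nat \<Rightarrow> (real \<Rightarrow> real) \<Rightarrow> (nat \<Rightarrow> nat) \<Rightarrow> (nat \<Rightarrow> real) \<Rightarrow> (nat \<Rightarrow> real) \<Rightarrow> nat
      \<Rightarrow> (nat \<Rightarrow> real) \<Rightarrow> bool"
  where "is_p_solution m f \<sigma> a b p x \<longleftrightarrow>
    (\<forall>n\<ge>p. (fwd_diff ^^ m) x n = a n * f (x (\<sigma> n)) + b n)"

definition Sol ::
    "nat \<Rightarrow> (real \<Rightarrow> real) \<Rightarrow> (nat \<Rightarrow> nat) \<Rightarrow> (nat \<Rightarrow> real) \<Rightarrow> (nat \<Rightarrow> real) \<Rightarrow> (nat \<Rightarrow> real) set"
  where "Sol m f \<sigma> a b = {x. \<forall>p. is_p_solution m f \<sigma> a b p x}"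

definition Sol_p ::
    "nat \<Rightarrow> (real \<Rightarrow> real) \<Rightarrow> (nat \<Rightarrow> nat) \<Rightarrow> (nat \<Rightarrow> real) \<Rightarrow> (nat \<Rightarrow> real) \<Rightarrow> nat \<Rightarrow> (nat \<Rightarrow> real) set"
  where "Sol_p m f \<sigma> a b p = {x. is_p_solution m f \<sigma> a b p x}"

definition Sol_inf ::
    "nat \<Rightarrow> (real \<Rightarrow> real) \<Rightarrow> (nat \<Rightarrow> nat) \<Rightarrow> (nat \<Rightarrow> real) \<Rightarrow> (nat \<Rightarrow> real) \<Rightarrow> (nat \<Rightarrow> real) set"
  where "Sol_inf m f \<sigma> a b = {x. \<exists>p. is_p_solution m f \<sigma> a b p x}"

definition inv_diff :: "nat \<Rightarrow> (nat \<Rightarrow> real) \<Rightarrow> (nat \<Rightarrow> real) set"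
  where "inv_diff m b = {y. (fwd_diff ^^ m) y = b}"

definition Fin :: "(nat \<Rightarrow> real) set"
  where "Fin = {x. finite {n. x n \<noteq> 0}}"

definition m_pair :: "nat \<Rightarrow> (nat \<Rightarrow> real) set \<Rightarrow> (nat \<Rightarrow> real) set \<Rightarrow> bool"
  where "m_pair m A Z \<longleftrightarrow>
    subspace A \<and> subspace Z \<and> Fin \<subseteq> Z \<and>
    (\<forall>u \<alpha>. Bseq u \<longrightarrow> \<alpha> \<in> A \<longrightarrow> u * \<alpha> \<in> A) \<and>
    A \<subseteq> (fwd_diff ^^ m) ` Z"

definition evanescent_m_pair :: "nat \<Rightarrow> (nat \<Rightarrow> real) set \<Rightarrow> (nat \<Rightarrow> real) set \<Rightarrow> bool"
  where "evanescent_m_pair m A Z \<longleftrightarrow> m_pair m A Z \<and> Z \<subseteq> {z. z \<longlonglongrightarrow> 0}"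

end

theory Submission
  imports Defs
begin

text \<open>A null sequence \<open>z\<close> is controlled by \<open>\<Delta>\<^sup>m z\<close>: if \<open>\<Delta>\<^sup>m z \<ge> 0\<close> then \<open>(-1)\<^sup>m z \<ge> 0\<close>.  Since \<open>\<bar>a\<bar> \<in> A\<close>, there
  is a null sequence \<open>w\<close> with \<open>\<Delta>\<^sup>m w = \<bar>a\<bar>\<close>, and \<open>\<rho> = (-1)\<^sup>m w\<close> dominates, up to a bound \<open>M\<close> of \<open>f\<close>,
  the sequence \<open>G x \<in> Z\<close> with \<open>\<Delta>\<^sup>m (G x) = a f(x \<circ> \<sigma>)\<close>.  For \<open>\<Delta>\<^sup>m y = b\<close>, the map
  \<open>x \<mapsto> y + G x\<close> is a continuous self-map of the box \<open>\<bar>x - y\<bar> \<le> M \<rho>\<close>, and a fixed point is a full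
  solution in \<open>y + Z\<close>.  Conversely, for a \<open>p\<close>-solution \<open>x\<close> the sequences \<open>\<Delta>\<^sup>m (x - G x)\<close> and \<open>b\<close>
  differ by an element of \<open>Fin\<close>, and \<open>Fin \<subseteq> \<Delta>\<^sup>m Fin\<close>.\<close>

section \<open>Fixed points of continuous self-maps of boxes of sequences\<close>

lemma tendsto_fun_iff:
  fixes f :: "'c \<Rightarrow> 'a \<Rightarrow> 'b::topological_space"
  shows "(f \<longlongrightarrow> x) F \<longleftrightarrow> (\<forall>i. ((\<lambda>k. f k i) \<longlongrightarrow> x i) F)"
  using limitin_componentwise[of "\<lambda>_. euclidean" UNIV f x F]
  by (simp add: euclidean_product_topology)

text \<open>Tychonoff's theorem gives compactness, and the space of real sequences is first
  countable, so sequential compactness follows.\<close>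

lemma seq_compact_box:
  fixes l u :: "nat \<Rightarrow> real"
  shows "seq_compact {x. \<forall>i. l i \<le> x i \<and> x i \<le> u i}"
proof -
  have "compactin (product_topology (\<lambda>_. euclidean) UNIV) (PiE UNIV (\<lambda>i. {l i..u i}))"
    by (subst compactin_PiE) auto
  moreover have "PiE UNIV (\<lambda>i. {l i..u i}) = {x. \<forall>i. l i \<le> x i \<and> x i \<le> u i}"
    by (auto simp: PiE_UNIV_domain)
  ultimately show ?thesis
    by (simp add: euclidean_product_topology compact_imp_seq_compact)
qed

text \<open>Kuhn's lemma, on the grid cutting each of the first \<open>k\<close> sides into
  \<open>k + 1\<close> equal pieces, yields a cell in which both labels occur for each of these
  coordinates. The corners with labels 0 and 1 are \<open>r\<close> and \<open>s\<close>, and the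
  bound is the mesh.\<close>

lemma box_approximate_fixpoint:
  fixes T :: "(nat \<Rightarrow> real) \<Rightarrow> nat \<Rightarrow> real" and l u :: "nat \<Rightarrow> real"
  defines "K \<equiv> {x. \<forall>i. l i \<le> x i \<and> x i \<le> u i}"
  assumes lu: "\<And>i. l i \<le> u i" and TK: "T ` K \<subseteq> K"
  shows "\<exists>q\<in>K. \<forall>i<k. \<exists>r\<in>K. \<exists>s\<in>K. r i \<le> T r i \<and> T s i \<le> s i \<and>
    (\<forall>j. \<bar>r j - q j\<bar> \<le> (u j - l j) / Suc k \<and> \<bar>s j - q j\<bar> \<le> (u j - l j) / Suc k)"
proof -
  define p where "p = Suc k"
  \<comment> \<open>Coordinate \<open>j < k\<close> of a grid point lies at the fraction
    \<open>x j / p\<close> of its interval. The other coordinates are frozen at the lower end, so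
    they add nothing to distances within a cell.\<close>
  define e where "e x j = (if j < k then l j + (u j - l j) * (real (x j) / real p) else l j)"
    for x :: "nat \<Rightarrow> nat" and j
  \<comment> \<open>Label 0 records that \<open>T\<close> does not lower coordinate
    \<open>i\<close>, label 1 that \<open>T\<close> does not raise it. Kuhn's lemma prescribes the
    labels on the faces \<open>x i = 0\<close> and \<open>x i = p\<close>; they are truthful because
    \<open>T\<close> maps \<open>K\<close> into itself.\<close>
  define lab where "lab x i = (if x i = 0 then 0 else if x i = p then 1
      else if e x i \<le> T (e x) i then 0 else (1::nat))" for x :: "nat \<Rightarrow> nat" and i
  have p: "p > 0" by (simp add: p_def)
  have eK: "e x \<in> K" if "\<forall>i<k. x i \<le> p" for x
  proof -
    have "l j \<le> e x j \<and> e x j \<le> u j" for j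
    proof (cases "j < k")
      case True
      have "0 \<le> real (x j) / real p" "real (x j) / real p \<le> 1"
        using that True p by auto
      then have "0 \<le> (u j - l j) * (real (x j) / real p)"
        "(u j - l j) * (real (x j) / real p) \<le> u j - l j"
        using lu[of j] by (simp, intro mult_left_le, simp_all)
      then show ?thesis using True by (simp add: e_def)
    qed (simp add: e_def lu)
    then show ?thesis by (simp add: K_def)
  qed
  have TeK: "T (e x) \<in> K" if "\<forall>i<k. x i \<le> p" for x
    using imageI[OF eK[OF that], of T] TK by (rule rev_subsetD)
  have lab0: "e x i \<le> T (e x) i" if "lab x i = 0" "i < k" "\<forall>i<k. x i \<le> p" for x i
  proof (cases "x i = 0")
    case True
    then show ?thesis using TeK[OF that(3)] that(2) by (simp add: e_def K_def)
  qed (use that(1) in \<open>auto simp: lab_def split: if_splits\<close>)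
  have lab1: "T (e x) i \<le> e x i" if "lab x i \<noteq> 0" "i < k" "\<forall>i<k. x i \<le> p" for x i
  proof (cases "x i = p")
    case True
    then show ?thesis using TeK[OF that(3)] that(2) p by (simp add: e_def K_def)
  qed (use that(1) in \<open>auto simp: lab_def split: if_splits\<close>)
  obtain q where q: "\<forall>i<k. q i < p"
    and cell: "\<forall>i<k. \<exists>r s. (\<forall>j<k. q j \<le> r j \<and> r j \<le> q j + 1) \<and>
      (\<forall>j<k. q j \<le> s j \<and> s j \<le> q j + 1) \<and> lab r i \<noteq> lab s i"
    by (rule kuhn_lemma[of p k lab]) (use p in \<open>auto simp: lab_def\<close>)
  have close: "\<bar>e r j - e q j\<bar> \<le> (u j - l j) / Suc k"
    if "\<forall>j<k. q j \<le> r j \<and> r j \<le> q j + 1" for r j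
  proof (cases "j < k")
    case True
    have "e r j - e q j = (u j - l j) * ((real (r j) - real (q j)) / real p)"
      using True by (simp add: e_def algebra_simps diff_divide_distrib)
    also have "\<bar>\<dots>\<bar> = (u j - l j) * (\<bar>real (r j) - real (q j)\<bar> / real p)"
      using lu[of j] by (simp add: abs_mult)
    also have "\<dots> \<le> (u j - l j) * (1 / real p)"
    proof (intro mult_left_mono divide_right_mono)
      show "\<bar>real (r j) - real (q j)\<bar> \<le> 1" using that True by force
    qed (use lu[of j] in auto)
    finally show ?thesis by (simp add: p_def)
  qed (use lu[of j] in \<open>simp add: e_def\<close>)
  have "\<exists>r\<in>K. \<exists>s\<in>K. r i \<le> T r i \<and> T s i \<le> s i \<and>
    (\<forall>j. \<bar>r j - e q j\<bar> \<le> (u j - l j) / Suc k \<and> \<bar>s j - e q j\<bar> \<le> (u j - l j) / Suc k)"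
    if i: "i < k" for i
  proof -
    obtain r s where r: "\<forall>j<k. q j \<le> r j \<and> r j \<le> q j + 1"
      and s: "\<forall>j<k. q j \<le> s j \<and> s j \<le> q j + 1" and "lab r i \<noteq> lab s i"
      using cell i by blast
    have rp: "\<forall>j<k. r j \<le> p"
    proof (intro allI impI)
      show "r j \<le> p" if "j < k" for j
        using r[rule_format, OF that] q[rule_format, OF that] by linarith
    qed
    have sp: "\<forall>j<k. s j \<le> p"
    proof (intro allI impI)
      show "s j \<le> p" if "j < k" for j
        using s[rule_format, OF that] q[rule_format, OF that] by linarith
    qed
    from \<open>lab r i \<noteq> lab s i\<close> consider "lab r i = 0" "lab s i \<noteq> 0" | "lab s i = 0" "lab r i \<noteq> 0"
      by (auto simp: lab_def split: if_splits)
    then show ?thesis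
    proof cases
      case 1
      show ?thesis
        by (rule bexI[OF _ eK[OF rp]], rule bexI[OF _ eK[OF sp]])
          (use lab0[OF 1(1) i rp] lab1[OF 1(2) i sp] close[OF r] close[OF s] in simp)
    next
      case 2
      show ?thesis
        by (rule bexI[OF _ eK[OF sp]], rule bexI[OF _ eK[OF rp]])
          (use lab0[OF 2(1) i sp] lab1[OF 2(2) i rp] close[OF r] close[OF s] in simp)
    qed
  qed
  moreover have "e q \<in> K" using q by (intro eK) (simp add: less_imp_le)
  ultimately show ?thesis by blast
qed

text \<open>On boxes the Schauder fixed point theorem needs no finite-dimensional Brouwer theorem: Kuhn's
  lemma is applied directly to ever finer grids in ever more coordinates, and the grid cells
  accumulate at a fixed point.\<close>

theorem schauder_box:
  fixes T :: "(nat \<Rightarrow> real) \<Rightarrow> nat \<Rightarrow> real" and l u :: "nat \<Rightarrow> real"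
  defines "K \<equiv> {x. \<forall>i. l i \<le> x i \<and> x i \<le> u i}"
  assumes lu: "\<And>i. l i \<le> u i" and cont: "continuous_on K T" and TK: "T ` K \<subseteq> K"
  obtains x where "x \<in> K" "T x = x"
proof -
  have "\<exists>q. \<forall>k. q k \<in> K \<and> (\<forall>i<k. \<exists>r\<in>K. \<exists>s\<in>K. r i \<le> T r i \<and> T s i \<le> s i \<and>
    (\<forall>j. \<bar>r j - q k j\<bar> \<le> (u j - l j) / Suc k \<and> \<bar>s j - q k j\<bar> \<le> (u j - l j) / Suc k))"
    using box_approximate_fixpoint[OF lu TK[unfolded K_def]] unfolding K_def[symmetric]
    by (intro choice) blast
  then obtain q where qK: "\<And>k. q k \<in> K" and
    near: "\<And>k i. i < k \<Longrightarrow> \<exists>r\<in>K. \<exists>s\<in>K. r i \<le> T r i \<and> T s i \<le> s i \<and>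
    (\<forall>j. \<bar>r j - q k j\<bar> \<le> (u j - l j) / Suc k \<and> \<bar>s j - q k j\<bar> \<le> (u j - l j) / Suc k)"
    by blast
  obtain x g where x: "x \<in> K" and g: "strict_mono g" and lim: "(q \<circ> g) \<longlonglongrightarrow> x"
    using seq_compact_box[of l u] qK unfolding K_def seq_compact_def by blast
  \<comment> \<open>Points within one mesh of \<open>q (g k)\<close> share its limit, as the mesh
    tends to 0 in each coordinate. This serves both corner sequences below.\<close>
  have near_lim: "(\<lambda>k. T (r k) i) \<longlonglongrightarrow> T x i" "(\<lambda>k. r k i) \<longlonglongrightarrow> x i"
    if rK: "\<And>k. r k \<in> K"
      and r: "\<forall>\<^sub>F k in sequentially. \<forall>j. \<bar>r k j - q (g k) j\<bar> \<le> (u j - l j) / Suc (g k)" for r i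
  proof -
    have "(\<lambda>k. r k j) \<longlonglongrightarrow> x j" for j
    proof (rule Lim_transform)
      show "(\<lambda>k. q (g k) j) \<longlonglongrightarrow> x j"
        using lim by (simp add: tendsto_fun_iff)
      have "(\<lambda>k. (u j - l j) / real (Suc (g k))) \<longlonglongrightarrow> 0"
        using LIMSEQ_subseq_LIMSEQ[OF lim_const_over_n[of "u j - l j", THEN LIMSEQ_Suc] g]
        by (simp add: o_def)
      then show "(\<lambda>k. r k j - q (g k) j) \<longlonglongrightarrow> 0"
        by (rule Lim_null_comparison[rotated])
          (use r in eventually_elim, simp)
    qed
    then have "r \<longlonglongrightarrow> x" and *: "(\<lambda>k. r k i) \<longlonglongrightarrow> x i" by (simp_all add: tendsto_fun_iff)
    have "(\<lambda>k. T (r k)) \<longlonglongrightarrow> T x"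
      by (rule continuous_on_tendsto_compose[OF cont \<open>r \<longlonglongrightarrow> x\<close> x]) (simp add: rK)
    then show "(\<lambda>k. T (r k) i) \<longlonglongrightarrow> T x i" by (simp add: tendsto_fun_iff)
    show "(\<lambda>k. r k i) \<longlonglongrightarrow> x i" by (fact *)
  qed
  have "T x i = x i" for i
  proof -
    \<comment> \<open>Suitable corners for coordinate \<open>i\<close> are available only once
      \<open>i < g k\<close>; for the finitely many other \<open>k\<close>, any point of
      \<open>K\<close>, such as \<open>q (g k)\<close>, fills the sequences.\<close>
    have "\<forall>k. \<exists>r s. r \<in> K \<and> s \<in> K \<and> (i < g k \<longrightarrow> r i \<le> T r i \<and> T s i \<le> s i \<and>
      (\<forall>j. \<bar>r j - q (g k) j\<bar> \<le> (u j - l j) / Suc (g k) \<and> \<bar>s j - q (g k) j\<bar> \<le> (u j - l j) / Suc (g k)))"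
      using near[of i] qK by blast
    then obtain r s where rK: "\<And>k. r k \<in> K" and sK: "\<And>k. s k \<in> K" and
      rs: "\<And>k. i < g k \<Longrightarrow> r k i \<le> T (r k) i \<and> T (s k) i \<le> s k i \<and>
      (\<forall>j. \<bar>r k j - q (g k) j\<bar> \<le> (u j - l j) / Suc (g k) \<and> \<bar>s k j - q (g k) j\<bar> \<le> (u j - l j) / Suc (g k))"
      unfolding choice_iff by blast
    have ev: "\<forall>\<^sub>F k in sequentially. i < g k"
      using filterlim_subseq[OF g, unfolded filterlim_at_top, rule_format, of "Suc i"]
      by (simp add: Suc_le_eq)
    have R: "\<forall>\<^sub>F k in sequentially. \<forall>j. \<bar>r k j - q (g k) j\<bar> \<le> (u j - l j) / Suc (g k)"
      and S: "\<forall>\<^sub>F k in sequentially. \<forall>j. \<bar>s k j - q (g k) j\<bar> \<le> (u j - l j) / Suc (g k)"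
      using ev by (eventually_elim, use rs in blast)+
    have "x i \<le> T x i"
      by (rule tendsto_le[OF _ near_lim[OF rK R]]) (auto intro: eventually_mono[OF ev] simp: rs)
    moreover have "T x i \<le> x i"
      by (rule tendsto_le[OF _ near_lim(2,1)[OF sK S]]) (auto intro: eventually_mono[OF ev] simp: rs)
    ultimately show ?thesis by simp
  qed
  then show ?thesis using that x by blast
qed

section \<open>Iterated differences: linearity, null sequences, finite supports\<close>

lemma linear_fwd_diff_pow: "linear (fwd_diff ^^ m)"
proof (induction m)
  case (Suc m)
  have "linear fwd_diff"
    by (rule linearI) (auto simp: fwd_diff_def algebra_simps)
  then show ?case using linear_compose[OF Suc] by (simp add: o_def)
qed (simp add: id_def linear_ident)

lemma fwd_diff_pow_add: "(fwd_diff ^^ m) (x + y) = (fwd_diff ^^ m) x + (fwd_diff ^^ m) y"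
  by (rule linear_add[OF linear_fwd_diff_pow])

lemma fwd_diff_pow_diff: "(fwd_diff ^^ m) (x - y) = (fwd_diff ^^ m) x - (fwd_diff ^^ m) y"
  by (rule linear_diff[OF linear_fwd_diff_pow])

lemma fwd_diff_pow_scaleR: "(fwd_diff ^^ m) (c *\<^sub>R x) = c *\<^sub>R (fwd_diff ^^ m) x"
  by (rule linear_cmul[OF linear_fwd_diff_pow])

lemma fwd_diff_tendsto_0: "z \<longlonglongrightarrow> 0 \<Longrightarrow> fwd_diff z \<longlonglongrightarrow> 0"
  unfolding fwd_diff_def using tendsto_diff[OF LIMSEQ_Suc, of z 0 z 0] by simp

text \<open>Induction through \<open>fwd_diff z\<close>, which is again null: the claim for it makes
  \<open>(-1) ^ m * z\<close> increasing with limit 0, hence nonpositive, so each difference flips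
  the sign once.\<close>

lemma null_sign:
  assumes "z \<longlonglongrightarrow> 0" "\<And>n. 0 \<le> (fwd_diff ^^ m) z n"
  shows "0 \<le> (-1) ^ m * z n"
  using assms
proof (induction m arbitrary: z n)
  case (Suc m)
  have "0 \<le> (-1) ^ m * fwd_diff z k" for k
    using Suc.IH[OF fwd_diff_tendsto_0[OF Suc.prems(1)]] Suc.prems(2)
    by (simp add: funpow_swap1)
  then have "incseq (\<lambda>k. (-1) ^ m * z k)"
    by (intro incseq_SucI) (simp add: fwd_diff_def algebra_simps)
  moreover have "(\<lambda>k. (-1) ^ m * z k) \<longlonglongrightarrow> 0"
    using tendsto_mult_right_zero[OF Suc.prems(1)] .
  ultimately have "(-1) ^ m * z n \<le> 0" by (rule incseq_le)
  then show ?case by simp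
qed simp

text \<open>Both \<open>w - z\<close> and \<open>w + z\<close> are null with nonnegative
  \<open>m\<close>-th difference, so \<open>null_sign\<close> applies to each.\<close>

lemma null_comparison:
  assumes "z \<longlonglongrightarrow> 0" "w \<longlonglongrightarrow> 0" "\<And>n. \<bar>(fwd_diff ^^ m) z n\<bar> \<le> (fwd_diff ^^ m) w n"
  shows "\<bar>z n\<bar> \<le> (-1) ^ m * w n"
proof -
  have "0 \<le> (-1) ^ m * (w - z) n"
  proof (rule null_sign)
    show "w - z \<longlonglongrightarrow> 0" using tendsto_diff[OF assms(2,1)] by (simp add: fun_diff_def)
    show "0 \<le> (fwd_diff ^^ m) (w - z) k" for k
      using assms(3)[of k] by (simp add: fwd_diff_pow_diff)
  qed
  moreover have "0 \<le> (-1) ^ m * (w + z) n"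
  proof (rule null_sign)
    show "w + z \<longlonglongrightarrow> 0" using tendsto_add[OF assms(2,1)] by (simp add: plus_fun_def)
    show "0 \<le> (fwd_diff ^^ m) (w + z) k" for k
      using assms(3)[of k] by (simp add: fwd_diff_pow_add)
  qed
  ultimately show ?thesis
    by (cases "even m") (auto simp: abs_le_iff)
qed

text \<open>This supplies continuity of the map \<open>G\<close> below: convergence of
  \<open>m\<close>-th differences is carried back one summation at a time, and the common null
  majorant controls the tails uniformly in \<open>k\<close>.\<close>

lemma pointwise_tendsto_of_dominated:
  fixes v :: "'k \<Rightarrow> nat \<Rightarrow> real"
  assumes "\<And>n. ((\<lambda>k. (fwd_diff ^^ m) (v k) n) \<longlongrightarrow> 0) F"
    and "\<And>k n. \<bar>v k n\<bar> \<le> \<rho> n" and "\<rho> \<longlonglongrightarrow> 0"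
  shows "((\<lambda>k. v k n) \<longlongrightarrow> 0) F"
  using assms
proof (induction m arbitrary: v \<rho> n)
  case (Suc m)
  have D: "((\<lambda>k. fwd_diff (v k) i) \<longlongrightarrow> 0) F" for i
  proof (rule Suc.IH[where \<rho> = "\<lambda>i. \<rho> (Suc i) + \<rho> i"])
    show "((\<lambda>k. (fwd_diff ^^ m) (fwd_diff (v k)) i) \<longlongrightarrow> 0) F" for i
      using Suc.prems(1)[of i] by (simp add: funpow_swap1)
    show "\<bar>fwd_diff (v k) i\<bar> \<le> \<rho> (Suc i) + \<rho> i" for k i
      using Suc.prems(2)[of k i] Suc.prems(2)[of k "Suc i"] by (simp add: fwd_diff_def)
    show "(\<lambda>i. \<rho> (Suc i) + \<rho> i) \<longlonglongrightarrow> 0"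
      using tendsto_add[OF LIMSEQ_Suc[OF Suc.prems(3)] Suc.prems(3)] by simp
  qed
  show ?case
  proof (rule tendstoI)
    fix e :: real assume e: "e > 0"
    \<comment> \<open>Beyond \<open>N\<close> the majorant is below \<open>e / 2\<close> for all
      \<open>k\<close> at once, which leaves a finite sum of differences from \<open>n\<close> to
      \<open>n + N\<close>.\<close>
    obtain N where N: "\<And>i. i \<ge> N \<Longrightarrow> \<bar>\<rho> i\<bar> < e / 2"
      using LIMSEQ_D[OF Suc.prems(3), of "e / 2"] e by auto
    have tele: "v k (n + N) - v k n = (\<Sum>i=n..<n+N. fwd_diff (v k) i)" for k
      by (simp add: fwd_diff_def sum_Suc_diff')
    have "((\<lambda>k. \<Sum>i=n..<n+N. fwd_diff (v k) i) \<longlongrightarrow> 0) F"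
      using tendsto_sum[where I = "{n..<n+N}", OF D] by simp
    from tendstoD[OF this, of "e / 2"] e
    have "\<forall>\<^sub>F k in F. \<bar>\<Sum>i=n..<n+N. fwd_diff (v k) i\<bar> < e / 2" by simp
    then show "\<forall>\<^sub>F k in F. dist (v k n) 0 < e"
    proof eventually_elim
      case (elim k)
      then show ?case
        using tele[of k] Suc.prems(2)[of k "n + N"] N[of "n + N"] by simp
    qed
  qed
qed simp

lemma Fin_subset_fwd_diff_pow: "Fin \<subseteq> (fwd_diff ^^ m) ` Fin"
proof (induction m)
  case (Suc m)
  have "Fin \<subseteq> fwd_diff ` Fin"
  proof
    fix e assume "e \<in> Fin"
    then have "finite {n. e n \<noteq> 0}" by (simp add: Fin_def)
    then obtain N where N: "{n. e n \<noteq> 0} \<subseteq> {..<N}"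
      using finite_nat_bounded by blast
    \<comment> \<open>Subtracting the total sum makes the partial sums vanish from \<open>N\<close>
      on, rather than merely become constant.\<close>
    define g where "g n = (\<Sum>i<n. e i) - (\<Sum>i<N. e i)" for n
    have "g n = 0" if "n \<ge> N" for n
    proof -
      have "(\<Sum>i<N. e i) = (\<Sum>i<n. e i)"
        by (rule sum.mono_neutral_left) (use N that in auto)
      then show ?thesis by (simp add: g_def)
    qed
    then have "{n. g n \<noteq> 0} \<subseteq> {..<N}" by (auto simp: not_le[symmetric])
    then have "g \<in> Fin" using finite_subset by (auto simp: Fin_def)
    moreover have "fwd_diff g = e" by (auto simp: fwd_diff_def g_def)
    ultimately show "e \<in> fwd_diff ` Fin" by blast
  qed
  also have "\<dots> \<subseteq> fwd_diff ` (fwd_diff ^^ m) ` Fin"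
    using Suc by (rule image_mono)
  finally show ?case by (simp add: image_comp)
qed simp

section \<open>Solutions of the equation and of \<Delta>^m y = b, compared modulo
  \<open>Z\<close>\<close>

lemma evanescent_solution_near:
  fixes f :: "real \<Rightarrow> real"
  assumes pair: "evanescent_m_pair m A Z" and "a \<in> A"
    and "continuous_on UNIV f" and "bounded (range f)"
    and y: "(fwd_diff ^^ m) y = b"
  obtains x where "\<And>n. (fwd_diff ^^ m) x n = a n * f (x (\<sigma> n)) + b n" "x - y \<in> Z"
proof -
  have mult: "\<And>u. Bseq u \<Longrightarrow> u * a \<in> A" and AZ: "A \<subseteq> (fwd_diff ^^ m) ` Z"
    and null: "\<And>z. z \<in> Z \<Longrightarrow> z \<longlonglongrightarrow> 0"
    using pair \<open>a \<in> A\<close> by (auto simp: evanescent_m_pair_def m_pair_def)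
  obtain M where M: "\<And>t. \<bar>f t\<bar> \<le> M" and M0: "M > 0"
    using \<open>bounded (range f)\<close> by (auto simp: bounded_pos)
  \<comment> \<open>The bounded multiplier \<open>sgn (a n)\<close> turns \<open>a\<close> into its
    absolute value, which therefore lies in \<open>A\<close>.\<close>
  have "Bseq (\<lambda>n. sgn (a n))"
    by (rule BseqI'[where K = 1]) (simp add: sgn_if)
  from mult[OF this] AZ obtain w where "w \<in> Z" and "(fwd_diff ^^ m) w = (\<lambda>n. sgn (a n)) * a"
    by force
  then have w: "w \<longlonglongrightarrow> 0" and Dw: "(fwd_diff ^^ m) w n = \<bar>a n\<bar>" for n
    using null by (auto simp: sgn_mult_self_eq abs_sgn mult.commute)
  define \<rho> where "\<rho> n = (-1) ^ m * w n" for n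
  have \<rho>: "\<rho> \<longlonglongrightarrow> 0"
    unfolding \<rho>_def using tendsto_mult_right_zero[OF w] .
  have bound: "\<bar>z n\<bar> \<le> C * \<rho> n"
    if "z \<longlonglongrightarrow> 0" "\<And>n. \<bar>(fwd_diff ^^ m) z n\<bar> \<le> C * \<bar>a n\<bar>" for z C n
  proof -
    have "\<bar>z n\<bar> \<le> (-1) ^ m * (C *\<^sub>R w) n"
    proof (rule null_comparison[OF that(1)])
      show "C *\<^sub>R w \<longlonglongrightarrow> 0"
        using tendsto_mult_right_zero[OF w, of C] by (simp add: scaleR_fun_def)
          show "\<bar>(fwd_diff ^^ m) z k\<bar> \<le> (fwd_diff ^^ m) (C *\<^sub>R w) k" for k
        using that(2)[of k] by (simp only: fwd_diff_pow_scaleR scaleR_fun_apply Dw real_scaleR_def)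
    qed
    then show ?thesis by (simp add: \<rho>_def mult.left_commute)
  qed
  have "\<exists>z\<in>Z. (fwd_diff ^^ m) z = (\<lambda>n. f (x (\<sigma> n))) * a" for x
  proof -
    have "Bseq (\<lambda>n. f (x (\<sigma> n)))" by (rule BseqI'[where K = M]) (simp add: M)
    from mult[OF this] AZ show ?thesis by force
  qed
  \<comment> \<open>\<open>G\<close> comes from choice, without a formula; its size and continuity
    are read off from its \<open>m\<close>-th differences and its being null.\<close>
  then obtain G where GZ: "\<And>x. G x \<in> Z"
    and "\<And>x. (fwd_diff ^^ m) (G x) = (\<lambda>n. f (x (\<sigma> n))) * a"
    by metis
  then have DG: "(fwd_diff ^^ m) (G x) n = f (x (\<sigma> n)) * a n" for x n by simp
  have Gle: "\<bar>G x n\<bar> \<le> M * \<rho> n" for x n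
    by (rule bound) (use null GZ in \<open>auto simp: DG abs_mult intro!: mult_right_mono M\<close>)
  define K where "K = {x. \<forall>n. y n - M * \<rho> n \<le> x n \<and> x n \<le> y n + M * \<rho> n}"
  have "continuous_on K (\<lambda>x. y + G x)"
  proof (rule continuous_on_sequentiallyI)
    fix X :: "nat \<Rightarrow> nat \<Rightarrow> real" and x assume "X \<longlonglongrightarrow> x"
    then have X: "(\<lambda>k. X k n) \<longlonglongrightarrow> x n" for n by (simp add: tendsto_fun_iff)
    have "(\<lambda>k. (G (X k) - G x) n) \<longlonglongrightarrow> 0" for n
    proof (rule pointwise_tendsto_of_dominated)
      show "(\<lambda>k. (fwd_diff ^^ m) (G (X k) - G x) n) \<longlonglongrightarrow> 0" for n
      proof -
        have "(\<lambda>k. f (X k (\<sigma> n))) \<longlonglongrightarrow> f (x (\<sigma> n))"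
          using continuous_on_tendsto_compose[OF assms(3) X] by simp
        then have "(\<lambda>k. f (X k (\<sigma> n)) * a n - f (x (\<sigma> n)) * a n) \<longlonglongrightarrow> 0"
          by (intro LIM_zero tendsto_mult_right)
        then show ?thesis by (simp add: fwd_diff_pow_diff DG)
      qed
      show "\<bar>(G (X k) - G x) n\<bar> \<le> 2 * M * \<rho> n" for k n
        using Gle[of "X k" n] Gle[of x n] by simp
      show "(\<lambda>n. 2 * M * \<rho> n) \<longlonglongrightarrow> 0" by (rule tendsto_mult_right_zero[OF \<rho>])
    qed
    then have "(\<lambda>k. G (X k) n) \<longlonglongrightarrow> G x n" for n
      by (simp add: LIM_zero_iff)
    then show "(\<lambda>k. y + G (X k)) \<longlonglongrightarrow> y + G x"
      by (simp add: tendsto_fun_iff tendsto_add)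
  qed
  \<comment> \<open>The argument \<open>y\<close> of \<open>G\<close> is arbitrary here: any
    instance of \<open>Gle\<close> shows \<open>M * \<rho> n\<close> to be nonnegative.\<close>
  moreover have "y n - M * \<rho> n \<le> y n + M * \<rho> n" for n
    using Gle[of y n] by linarith
  moreover have "(\<lambda>x. y + G x) ` K \<subseteq> K"
  proof -
    have "y n - M * \<rho> n \<le> y n + G x n \<and> y n + G x n \<le> y n + M * \<rho> n" for x n
      using Gle[of x n] by linarith
    then show ?thesis by (auto simp: K_def)
  qed
  ultimately obtain x where x: "y + G x = x"
    unfolding K_def
    using schauder_box[of "\<lambda>n. y n - M * \<rho> n" "\<lambda>n. y n + M * \<rho> n" "\<lambda>x. y + G x"]
    by metis
  have "(fwd_diff ^^ m) x = b + (fwd_diff ^^ m) (G x)"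
    using fwd_diff_pow_add[of m y "G x"] by (simp add: x y)
  moreover have "x - y = G x" using x by (metis add_diff_cancel_left')
  ultimately show ?thesis
    using that[of x] GZ[of x] by (simp add: DG mult.commute)
qed

lemma m_pair_solution_near:
  fixes f :: "real \<Rightarrow> real"
  assumes pair: "m_pair m A Z" and "a \<in> A" and "bounded (range f)"
    and x: "is_p_solution m f \<sigma> a b p x"
  obtains y where "(fwd_diff ^^ m) y = b" "x - y \<in> Z"
proof -
  have mult: "\<And>u. Bseq u \<Longrightarrow> u * a \<in> A" and AZ: "A \<subseteq> (fwd_diff ^^ m) ` Z"
    and Z: "subspace Z" and Fin: "Fin \<subseteq> Z"
    using pair \<open>a \<in> A\<close> by (auto simp: m_pair_def)
  obtain M where M: "\<And>t. \<bar>f t\<bar> \<le> M"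
    using \<open>bounded (range f)\<close> by (auto simp: bounded_iff)
  have "Bseq (\<lambda>n. f (x (\<sigma> n)))" by (rule BseqI'[where K = M]) (simp add: M)
  from mult[OF this] AZ obtain z where z: "z \<in> Z" "(fwd_diff ^^ m) z = (\<lambda>n. f (x (\<sigma> n))) * a"
    by force
  \<comment> \<open>The defect \<open>e\<close> vanishes from \<open>p\<close> on, where
    \<open>x\<close> satisfies the equation; an antidifference \<open>g\<close> of it in
    \<open>Fin\<close> is then absorbed by \<open>Z\<close>.\<close>
  define e where "e = (fwd_diff ^^ m) x - (fwd_diff ^^ m) z - b"
  have "{n. e n \<noteq> 0} \<subseteq> {..<p}"
  proof
    fix n assume "n \<in> {n. e n \<noteq> 0}"
    then show "n \<in> {..<p}"
      using x by (cases "n < p") (auto simp: e_def z is_p_solution_def mult.commute)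
  qed
  then have "e \<in> Fin" unfolding Fin_def using finite_subset by blast
  then obtain g where g: "g \<in> Fin" "(fwd_diff ^^ m) g = e"
    using Fin_subset_fwd_diff_pow[of m] by auto
  have "(fwd_diff ^^ m) (x - (z + g)) = b"
    by (simp add: fwd_diff_pow_diff fwd_diff_pow_add g e_def)
  moreover have "x - (x - (z + g)) \<in> Z"
    using subspace_add[OF Z z(1)] g(1) Fin by auto
  ultimately show ?thesis using that by blast
qed

text \<open>Since \<open>Z\<close> is closed under addition, the correction \<open>x - y\<close>
  merges with the summand from \<open>Z\<close>. This turns the existence of nearby solutions into
  inclusions.\<close>

lemma set_plus_subspace_absorb:
  assumes "subspace Z" "\<And>x. x \<in> X \<Longrightarrow> \<exists>y\<in>Y. x - y \<in> Z"
  shows "X + Z \<subseteq> Y + Z"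
proof
  fix s assume "s \<in> X + Z"
  then obtain x z where "x \<in> X" "z \<in> Z" and s: "s = x + z" by (auto simp: set_plus_def)
  then obtain y where "y \<in> Y" "x - y \<in> Z" using assms(2) by blast
  moreover have "s = y + ((x - y) + z)" by (simp add: s)
  ultimately show "s \<in> Y + Z"
    using subspace_add[OF assms(1) _ \<open>z \<in> Z\<close>] by blast
qed

theorem theorem4:
  fixes m p :: nat
    and f :: "real \<Rightarrow> real"
    and \<sigma> :: "nat \<Rightarrow> nat"
    and a b :: "nat \<Rightarrow> real"
    and A Z :: "(nat \<Rightarrow> real) set"
  assumes "1 \<le> m"
    and "filterlim \<sigma> at_top sequentially"
    and "evanescent_m_pair m A Z"
    and "a \<in> A"
    and "continuous_on UNIV f"
    and "bounded (range f)"
  shows "Sol m f \<sigma> a b + Z = Sol_p m f \<sigma> a b p + Z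
       \<and> Sol_p m f \<sigma> a b p + Z = Sol_inf m f \<sigma> a b + Z
       \<and> Sol_inf m f \<sigma> a b + Z = inv_diff m b + Z"
proof -
  have pair: "m_pair m A Z" and Z: "subspace Z"
    using assms(3) by (auto simp: evanescent_m_pair_def m_pair_def)
  \<comment> \<open>A cycle of four inclusions makes all four sets equal; only the last two use the
    nearby solutions.\<close>
  have "Sol m f \<sigma> a b + Z \<subseteq> Sol_p m f \<sigma> a b p + Z"
    by (rule set_plus_mono2) (auto simp: Sol_def Sol_p_def)
  moreover have "Sol_p m f \<sigma> a b p + Z \<subseteq> Sol_inf m f \<sigma> a b + Z"
    by (rule set_plus_mono2) (auto simp: Sol_inf_def Sol_p_def)
  moreover have "Sol_inf m f \<sigma> a b + Z \<subseteq> inv_diff m b + Z"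
    by (rule set_plus_subspace_absorb[OF Z])
      (auto simp: Sol_inf_def inv_diff_def elim: m_pair_solution_near[OF pair assms(4,6)])
  moreover have "inv_diff m b + Z \<subseteq> Sol m f \<sigma> a b + Z"
  proof (rule set_plus_subspace_absorb[OF Z])
    fix y assume "y \<in> inv_diff m b"
    then obtain x where x: "\<And>n. (fwd_diff ^^ m) x n = a n * f (x (\<sigma> n)) + b n" "x - y \<in> Z"
      using evanescent_solution_near[OF assms(3-6), of y b \<sigma>] by (auto simp: inv_diff_def)
    moreover have "y - x \<in> Z"
      using subspace_neg[OF Z x(2)] by simp
    ultimately show "\<exists>x\<in>Sol m f \<sigma> a b. y - x \<in> Z"
      by (auto simp: Sol_def is_p_solution_def)
  qed
  ultimately show ?thesis by blast
qed

end
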